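(* For all $\eta,\eta'\in\mathbb{C}$ and all $w,x,y,z\in\mathbb{Z}/3\mathbb{Z}$ with $y\neq z$, the following identities of $3\times 3$ complex matrices hold: (1) $\mathcal{S}[\eta,\eta']=\mathcal{S}[\eta\omega,\eta'\omega^{-1}]\cdot J=J\cdot\mathcal{S}[\eta\omega,\eta'\omega^{-1}]$; (2) $\mathcal{M}^{wx/yz}[\eta,\eta']=\mathcal{M}^{w+1,x+1/y+1,z+1}[\eta,\eta']$; (3) $\mathcal{M}^{wx/yz}[\eta,\eta']\cdot J=\mathcal{M}^{w+1,x+1/yz}[\eta,\eta']$; (4) $\mathcal{M}^{wx/yz}[\eta,\eta']\cdot J^2=\mathcal{M}^{wx/y+1,z+1}[\eta,\eta']$; (5) $\mathcal{M}^{wx/yz}[\eta,\eta']=\mathcal{M}^{w,x+1/yz}[\eta\omega,\eta'\omega^{-1}]=\mathcal{M}^{w,x-1/yz}[\eta\omega^{-1},\eta'\omega]$; (6) $\frac13\left(\mathcal{M}^{w0/yz}[\eta,\eta']+\mathcal{M}^{w1/yz}[\eta,\eta']+\mathcal{M}^{w2/yz}[\eta,\eta']\right)=\frac13J^{w+y+z}+\frac23J^{w-y}$; (7) $\frac12\left(\mathcal{M}^{wx/yz}[\eta,\eta']+\mathcal{M}^{wx/zy}[\eta,\eta']\right)=\mathcal{S}_{\frac12,\frac12}=\frac13(I+J+J^2)$; (8) $\mathcal{M}^{wx/yz}[\omega^{x-w}+\eta,\ \omega^{w-x}+\eta']=J^{x}\cdot\mathcal{M}^{00/yz}[1+\eta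,1+\eta']$.
   Context: Let $\omega=e^{2\pi i/3}$. A triangle triple is a vector $\Delta=(a_0,a_1,a_2)\in\mathbb{C}^3$ (degenerate triples allowed), viewed as a column vector with coordinates indexed by $\mathbb{Z}/3\mathbb{Z}$; its centroid is $\frac13(a_0+a_1+a_2)$. Put $$I=\begin{pmatrix}1&0&0\\0&1&0\\0&0&1\end{pmatrix},\quad J=\begin{pmatrix}0&1&0\\0&0&1\\1&0&0\end{pmatrix},\quad W=\begin{pmatrix}1&1&1\\1&\omega&\omega^2\\1&\omega^2&\omega\end{pmatrix}.$$ Since $J^3=I$ and $\omega^3=1$, $J^{x}$ and $\omega^{x}$ make sense for $x\in\mathbb{Z}/3\mathbb{Z}$. Generalized cevian operator: for $\eta,\eta'\in\mathbb{C}$, $\mathcal{S}[\eta,\eta']:=W\,\mathrm{diag}(1,\eta',\eta)\,W^{-1}\in M_3(\mathbb{C})$, acting on $\mathbb{C}^3$ on the left. It preserves centroids. For $p,q\in\mathbb{C}$ with $pq\neq1$, $\mathcal{S}_{p,q}:=\frac{p(1-q)}{1-pq}I+\frac{q(1-p)}{1-pq}J+\frac{(1-p)(1-q)}{1-pq}J^2$. Generalized median operator: for $\eta,\eta'\in\mathbb{C}$ and $w,x,y,z\in\mathbb{Z}/3\mathbb{Z}$ with $y\ne z$, and a triangle triple $\Delta=(a_0,a_1,a_2)$ with $\mathcal{S}[\eta,\eta'](\Delta)=(a_0',a_1',a_2')$, define $\mathcal{M}^{wx/yz}[\eta,\eta'](\Delta)=(a_0'',a_1'',a_2'')$ to be the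 unique triangle triple having the same centroid as $\Delta$ and satisfying $a'_{x+k}-a_{w+k}=a''_{z+k}-a''_{y+k}$ for all $k\in\mathbb{Z}/3\mathbb{Z}$. The operator $\mathcal{M}^{wx/yz}[\eta,\eta']$ is linear and is identified with its matrix in $M_3(\mathbb{C})$. *)

theory Defs
  imports "HOL-Analysis.Analysis"
begin

text \<open>
  The numeral type \<open>3\<close> carries arithmetic modulo 3, so it serves as the ring of integers
  modulo 3, with elements \<open>0, 1, 2\<close> (and \<open>3 = 0\<close>).  The library's \<open>vector [a, b, c]\<close> places
  its entries at the indices \<open>1, 2, 3\<close>, that is, puts \<open>c\<close> at index \<open>0\<close>; hence the separate
  constructor below, which starts at index \<open>0\<close>.
\<close>

type_synonym triple = "complex ^ 3"
type_synonym cmat = "complex ^ 3 ^ 3"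

definition tuple3 :: "'a \<Rightarrow> 'a \<Rightarrow> 'a \<Rightarrow> 'a ^ 3" where
  "tuple3 a b c = (\<chi> k. if k = 0 then a else if k = 1 then b else c)"

definition \<omega> :: complex where
  "\<omega> = exp (2 * of_real pi * \<i> / 3)"

definition centroid :: "triple \<Rightarrow> complex" where
  "centroid \<Delta> = (\<Delta> $ 0 + \<Delta> $ 1 + \<Delta> $ 2) / 3"

definition matJ :: cmat where
  "matJ = tuple3 (tuple3 0 1 0)
                 (tuple3 0 0 1)
                 (tuple3 1 0 0)"

definition matW :: cmat where
  "matW = tuple3 (tuple3 1 1       1)
                 (tuple3 1 \<omega>       (\<omega> ^ 2))
                 (tuple3 1 (\<omega> ^ 2) \<omega>)"

definition diag3 :: "complex \<Rightarrow> complex \<Rightarrow> complex \<Rightarrow> cmat" where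
  "diag3 a b c = tuple3 (tuple3 a 0 0)
                        (tuple3 0 b 0)
                        (tuple3 0 0 c)"

text \<open>
  Exponents modulo 3 are evaluated at the representative in \<open>{0, 1, 2}\<close>.  On matrices the
  library's \<open>^\<close> is the entrywise power, so powers of \<open>matJ\<close> are iterated matrix products.
\<close>

definition rep3 :: "3 \<Rightarrow> nat" where
  "rep3 x = nat (Rep_bit1 x)"

definition omega_pow :: "3 \<Rightarrow> complex" where
  "omega_pow x = \<omega> ^ rep3 x"

definition J_pow :: "3 \<Rightarrow> cmat" where
  "J_pow x = (((**) matJ) ^^ rep3 x) (mat 1)"

definition cscale :: "complex \<Rightarrow> cmat \<Rightarrow> cmat" where
  "cscale c A = map_matrix ((*) c) A"

definition cevian :: "complex \<Rightarrow> complex \<Rightarrow> cmat" where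
  "cevian \<eta> \<eta>' = matW ** diag3 1 \<eta>' \<eta> ** matrix_inv matW"

text \<open>Only meaningful for \<open>p * q \<noteq> 1\<close>.\<close>

definition cevian_pq :: "complex \<Rightarrow> complex \<Rightarrow> cmat" where
  "cevian_pq p q =
     cscale (p * (1 - q) / (1 - p * q)) (mat 1)
   + cscale (q * (1 - p) / (1 - p * q)) matJ
   + cscale ((1 - p) * (1 - q) / (1 - p * q)) (matJ ** matJ)"

definition is_median_triple ::
  "3 \<Rightarrow> 3 \<Rightarrow> 3 \<Rightarrow> 3 \<Rightarrow> complex \<Rightarrow> complex \<Rightarrow> triple \<Rightarrow> triple \<Rightarrow> bool" where
  "is_median_triple w x y z \<eta> \<eta>' \<Delta> \<Delta>'' \<longleftrightarrow>
     centroid \<Delta>'' = centroid \<Delta> \<and>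
     (\<forall>k. (cevian \<eta> \<eta>' *v \<Delta>) $ (x + k) - \<Delta> $ (w + k) = \<Delta>'' $ (z + k) - \<Delta>'' $ (y + k))"

definition median_op ::
  "3 \<Rightarrow> 3 \<Rightarrow> 3 \<Rightarrow> 3 \<Rightarrow> complex \<Rightarrow> complex \<Rightarrow> triple \<Rightarrow> triple" where
  "median_op w x y z \<eta> \<eta>' \<Delta> = (THE \<Delta>''. is_median_triple w x y z \<eta> \<eta>' \<Delta> \<Delta>'')"

text \<open>\<open>median w x y z \<eta> \<eta>'\<close> is \<open>\<M>\<^bsup>wx/yz\<^esup>[\<eta>, \<eta>']\<close>, meaningful for \<open>y \<noteq> z\<close>.\<close>

definition median ::
  "3 \<Rightarrow> 3 \<Rightarrow> 3 \<Rightarrow> 3 \<Rightarrow> complex \<Rightarrow> complex \<Rightarrow> cmat" where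
  "median w x y z \<eta> \<eta>' = matrix (median_op w x y z \<eta> \<eta>')"


text \<open>
  Well-definedness: \<open>matW\<close> is invertible, exponents modulo 3 agree with natural exponents, the
  defining conditions of the median triple have exactly one solution, and the resulting
  operator is linear, hence given by its matrix.
\<close>

lemma UNIV_3': "(UNIV :: 3 set) = {0, 1, 2}"
  using UNIV_3 by auto

lemma sum_UNIV_3': "sum f (UNIV :: 3 set) = f 0 + f 1 + (f 2 :: 'a::comm_monoid_add)"
  unfolding UNIV_3' by (simp add: add.assoc)

lemma all_3': "(\<forall>k::3. P k) \<longleftrightarrow> P 0 \<and> P 1 \<and> P 2"
  using UNIV_3' by (metis UNIV_I insertE singletonD)

lemma tuple3_nth [simp]:
  "tuple3 a b c $ 0 = a" "tuple3 a b c $ 1 = b" "tuple3 a b c $ 2 = c"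
  by (simp_all add: tuple3_def)

lemma mod3_reduce:
  "(3::3) = 0" "(4::3) = 1" "(5::3) = 2" "(6::3) = 0"
  "- (1::3) = 2" "- (2::3) = 1" "- (3::3) = 0" "- (4::3) = 2"
  by simp_all

lemma omega_cis: "\<omega> = cis (2 * pi / 3)"
  by (simp add: \<omega>_def cis_conv_exp mult_ac)

lemma omega_cubed: "\<omega> ^ 3 = 1"
  unfolding omega_cis Complex.DeMoivre by simp

lemma omega_ne_1: "\<omega> \<noteq> 1"
proof
  assume "\<omega> = 1"
  then have "cos (2 * pi / 3) = 1"
    using omega_cis by (metis cis.sel(1) one_complex.sel(1))
  then show False using cos_120 by linarith
qed

lemma omega_sum: "1 + \<omega> + \<omega> ^ 2 = 0"
proof -
  have "(\<omega> - 1) * (1 + \<omega> + \<omega> ^ 2) = \<omega> ^ 3 - 1"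
    by (simp add: algebra_simps power2_eq_square power3_eq_cube)
  then have "(\<omega> - 1) * (1 + \<omega> + \<omega> ^ 2) = 0"
    by (simp only: omega_cubed diff_self)
  moreover have "\<omega> - 1 \<noteq> 0" using omega_ne_1 by (simp only: right_minus_eq not_False_eq_True)
  ultimately show ?thesis by (simp only: mult_eq_0_iff simp_thms)
qed

definition matV :: cmat where
  "matV = cscale (1 / 3) (tuple3 (tuple3 1 1       1)
                                 (tuple3 1 (\<omega> ^ 2) \<omega>)
                                 (tuple3 1 \<omega>       (\<omega> ^ 2)))"

lemma omega_sq: "\<omega> ^ 2 = - 1 - \<omega>"
proof -
  have "\<omega> ^ 2 = (1 + \<omega> + \<omega> ^ 2) - 1 - \<omega>" by simp
  then show ?thesis by (simp only: omega_sum diff_0)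
qed

lemma W_V: "matW ** matV = mat 1" and V_W: "matV ** matW = mat 1"
proof -
  have o2: "\<omega> * \<omega> = - 1 - \<omega>" using omega_sq by (simp only: power2_eq_square)
  have "\<omega> * (\<omega> * u) = - u - \<omega> * u" for u
    by (simp only: mult.assoc[symmetric] o2) (simp add: left_diff_distrib)
  note sq = o2 this
  show "matW ** matV = mat 1" "matV ** matW = mat 1"
    by (simp_all add: vec_eq_iff all_3' matrix_matrix_mult_def sum_UNIV_3' matW_def matV_def
        cscale_def map_matrix_def mat_def power2_eq_square sq algebra_simps
        add_divide_distrib diff_divide_distrib)
qed

lemma invertible_W: "invertible matW"
  unfolding invertible_def using W_V V_W by blast

lemma matrix_inv_W: "matrix_inv matW = matV"
proof -
  have "matW ** matrix_inv matW = mat 1"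
    using invertible_W unfolding invertible_def matrix_inv_def by (rule someI2_ex) simp
  then show ?thesis
    using V_W by (metis matrix_mul_assoc matrix_mul_lid matrix_mul_rid)
qed

lemma rep3_simps: "rep3 0 = 0" "rep3 1 = 1" "rep3 2 = 2"
proof -
  have "(2::3) = Abs_bit1' 2"
    using bit1.of_int_eq[of 2, where 'a = num1] by (simp add: Abs_bit1'_def)
  then have "Rep_bit1 (2::3) = 2"
    using Abs_bit1'_code[of 2, where 'a = num1] by simp
  then show "rep3 2 = 2" by (simp add: rep3_def)
qed (simp_all add: rep3_def bit1.Rep_0 bit1.Rep_1)

lemma rep3_of_nat: "rep3 (of_nat n) = n mod 3"
proof -
  have 3: "(3::3) = 0" by simp
  have "(of_nat n :: 3) = of_nat (n mod 3 + 3 * (n div 3))" by simp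
  also have "\<dots> = of_nat (n mod 3)"
    by (simp only: of_nat_add of_nat_mult of_nat_numeral 3 mult_zero_left add_0_right)
  finally have e: "(of_nat n :: 3) = of_nat (n mod 3)" .
  have "n mod 3 = 0 \<or> n mod 3 = 1 \<or> n mod 3 = 2" by presburger
  then show ?thesis unfolding e using rep3_simps by auto
qed

lemma J_cubed: "matJ ** (matJ ** matJ) = mat 1"
  by (simp add: vec_eq_iff all_3' matrix_matrix_mult_def sum_UNIV_3' matJ_def mat_def)

lemma omega_pow_of_nat: "omega_pow (of_nat n) = \<omega> ^ n"
proof -
  have "\<omega> ^ n = \<omega> ^ (3 * (n div 3) + n mod 3)" by simp
  also have "\<dots> = \<omega> ^ (n mod 3)" by (simp only: power_add power_mult omega_cubed power_one mult_1)
  finally show ?thesis by (simp add: omega_pow_def rep3_of_nat)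
qed

lemma J_pow_of_nat: "J_pow (of_nat n) = (((**) matJ) ^^ n) (mat 1)"
proof -
  have 3: "(((**) matJ) ^^ 3) = (id :: cmat \<Rightarrow> cmat)"
    by (rule ext) (simp add: numeral_3_eq_3 matrix_mul_assoc J_cubed[unfolded matrix_mul_assoc])
  have "((((**) matJ) ^^ n) :: cmat \<Rightarrow> cmat) = (((**) matJ) ^^ (n mod 3 + 3 * (n div 3)))" by simp
  also have "\<dots> = (((**) matJ) ^^ (n mod 3))"
    by (simp only: funpow_add funpow_mult[symmetric] 3) (simp add: mult.commute[of 3] 3 flip: funpow_mult)
  finally show ?thesis by (simp only: J_pow_def rep3_of_nat)
qed

lemma centroid_cevian: "centroid (cevian \<eta> \<eta>' *v \<Delta>) = centroid \<Delta>"
proof -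
  have c: "centroid (matW *v u) = u $ 0" for u
  proof -
    have "centroid (matW *v u) = (3 * u $ 0 + (1 + \<omega> + \<omega>^2) * (u $ 1 + u $ 2)) / 3"
      by (simp add: centroid_def matW_def matrix_vector_mult_def sum_UNIV_3' algebra_simps)
    then show ?thesis by (simp add: omega_sum)
  qed
  have d: "(diag3 1 \<eta>' \<eta> *v u) $ 0 = u $ 0" for u
    by (simp add: diag3_def matrix_vector_mult_def sum_UNIV_3')
  have v: "(matV *v u) $ 0 = centroid u" for u
    by (simp add: centroid_def matV_def cscale_def map_matrix_def matrix_vector_mult_def
        sum_UNIV_3' add_divide_distrib)
  show ?thesis
    by (simp add: cevian_def matrix_inv_W c d v flip: matrix_vector_mul_assoc)
qed

lemma ex1_differences:
  fixes y z :: 3 and d :: triple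
  assumes "y \<noteq> z" and "d $ 0 + d $ 1 + d $ 2 = 0"
  shows "\<exists>!u. centroid u = c \<and> (\<forall>k. d $ k = u $ (z + k) - u $ (y + k))"
proof -
  have three: "y = 0 \<or> y = 1 \<or> y = 2" "z = 0 \<or> z = 1 \<or> z = 2"
    using UNIV_3' by blast+
  define e where "e = (\<lambda>k. c - (2 * d $ (k - y) + d $ (k - y + (z - y))) / 3)"
  have d2: "d $ 2 = - d $ 0 - d $ 1" using assms(2) by (simp add: algebra_simps eq_neg_iff_add_eq_0)
  show ?thesis
  proof (rule ex1I[of _ "\<chi> k. e k"])
    show "centroid (\<chi> k. e k) = c \<and> (\<forall>k. d $ k = (\<chi> k. e k) $ (z + k) - (\<chi> k. e k) $ (y + k))"
      using three assms(1)
      by (auto simp: e_def centroid_def all_3' mod3_reduce d2 field_simps)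
  next
    fix u assume u: "centroid u = c \<and> (\<forall>k. d $ k = u $ (z + k) - u $ (y + k))"
    then have c: "c = (u $ 0 + u $ 1 + u $ 2) / 3" by (simp add: centroid_def)
    from u have d: "d $ k = u $ (z + k) - u $ (y + k)" for k by blast
    show "u = (\<chi> k. e k)"
      using three assms(1)
      by (auto simp: e_def c d vec_eq_iff all_3' mod3_reduce field_simps)
  qed
qed

lemma ex1_median_triple:
  assumes "y \<noteq> z"
  shows "\<exists>!\<Delta>''. is_median_triple w x y z \<eta> \<eta>' \<Delta> \<Delta>''"
proof -
  define D where "D = (\<chi> k. (cevian \<eta> \<eta>' *v \<Delta>) $ (x + k) - \<Delta> $ (w + k))"
  have shift: "a $ (i + 0) + a $ (i + 1) + a $ (i + 2) = 3 * centroid a" for a :: triple and i :: 3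
  proof -
    have "i = 0 \<or> i = 1 \<or> i = 2" using UNIV_3' by blast
    then show ?thesis by (auto simp: centroid_def mod3_reduce)
  qed
  have "D $ 0 + D $ 1 + D $ 2 = 0"
    using shift[of "cevian \<eta> \<eta>' *v \<Delta>" x] shift[of \<Delta> w] centroid_cevian[of \<eta> \<eta>' \<Delta>]
    by (simp add: D_def algebra_simps)
  from ex1_differences[OF assms this, of "centroid \<Delta>"]
  show ?thesis by (simp add: is_median_triple_def D_def)
qed

lemma median_op_iff:
  assumes "y \<noteq> z"
  shows "median_op w x y z \<eta> \<eta>' \<Delta> = u \<longleftrightarrow> is_median_triple w x y z \<eta> \<eta>' \<Delta> u"
proof -
  note ex1 = ex1_median_triple[OF assms, of w x \<eta> \<eta>' \<Delta>]
  show ?thesis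
    unfolding median_op_def using theI'[OF ex1] the1_equality[OF ex1] by blast
qed

lemma linear_median_op:
  assumes "y \<noteq> z"
  shows "Vector_Spaces.linear (*s) (*s) (median_op w x y z \<eta> \<eta>')"
proof -
  define f where "f = median_op w x y z \<eta> \<eta>'"
  have c: "centroid (f a) = centroid a"
    and d: "f a $ (z + k) - f a $ (y + k) = (cevian \<eta> \<eta>' *v a) $ (x + k) - a $ (w + k)" for a k
    using median_op_iff[OF assms, of w x \<eta> \<eta>' a "f a"]
    by (simp_all add: f_def is_median_triple_def)
  have add: "f (a + b) = f a + f b" for a b
  proof -
    have "centroid (f a + f b) = centroid (a + b)"
    proof -
      have "centroid (u + v) = centroid u + centroid v" for u v
        by (simp add: centroid_def add_divide_distrib)
      then show ?thesis by (simp only: c)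
    qed
    moreover have "(cevian \<eta> \<eta>' *v (a + b)) $ (x + k) - (a + b) $ (w + k)
        = (f a + f b) $ (z + k) - (f a + f b) $ (y + k)" for k
      using d[of a k] d[of b k] by (simp add: matrix_vector_right_distrib algebra_simps)
    ultimately show ?thesis
      unfolding f_def median_op_iff[OF assms] is_median_triple_def by blast
  qed
  have scale: "f (r *s a) = r *s f a" for r a
  proof -
    have "centroid (r *s f a) = centroid (r *s a)"
    proof -
      have "centroid (r *s u) = r * centroid u" for u
        by (simp add: centroid_def algebra_simps)
      then show ?thesis by (simp only: c)
    qed
    moreover have "(cevian \<eta> \<eta>' *v (r *s a)) $ (x + k) - (r *s a) $ (w + k)
        = (r *s f a) $ (z + k) - (r *s f a) $ (y + k)" for k
      using d[of a k] by (simp add: vector_scalar_commute flip: right_diff_distrib)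
    ultimately show ?thesis
      unfolding f_def median_op_iff[OF assms] is_median_triple_def by blast
  qed
  show ?thesis
    unfolding f_def[symmetric] Vector_Spaces.linear_iff
    using add scale vec.vector_space_axioms by blast
qed

lemma median_works:
  assumes "y \<noteq> z"
  shows "median w x y z \<eta> \<eta>' *v \<Delta> = median_op w x y z \<eta> \<eta>' \<Delta>"
  unfolding median_def using linear_median_op[OF assms] by (rule matrix_works)

end

(* The discrete Fourier matrix W diagonalises J, with eigenvalues 1, \<omega>, \<omega>^-1, hence also every
   cevian operator; the defining equation of the median operator reads
   (J^z - J^y) M = J^x S - J^w, so W diagonalises M as well.  M has eigenvalue 1 on the constant
   vectors, and (\<zeta>^x e - \<zeta>^w) / (\<zeta>^z - \<zeta>^y) at the two primitive cube roots of unity \<zeta>, where e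
   is the corresponding eigenvalue of S.  Each matrix identity is thus a scalar identity for such
   quotients, to be checked at a primitive cube root of unity. *)

theory Submission
  imports Defs
begin

section \<open>Circulant matrices and their eigenvalues\<close>

text \<open>The circulant matrix acting by \<open>a\<close>, \<open>b\<close>, \<open>c\<close> on
  the three columns of \<open>matW\<close>; \<open>matV\<close> is the explicit inverse of
  \<open>matW\<close>. Sums, products and scalings become componentwise.\<close>

definition spectral :: "complex \<Rightarrow> complex \<Rightarrow> complex \<Rightarrow> cmat" where
  "spectral a b c = matW ** diag3 a b c ** matV"

lemma cevian_eq_spectral: "cevian \<eta> \<eta>' = spectral 1 \<eta>' \<eta>"
  by (simp add: cevian_def spectral_def matrix_inv_W)

lemma mat_1_eq_spectral: "mat 1 = spectral 1 1 1"
proof -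
  have "diag3 1 1 1 = mat 1"
    by (simp add: diag3_def vec_eq_iff all_3' mat_def)
  then show ?thesis by (simp add: spectral_def W_V)
qed

lemma spectral_mult: "spectral a b c ** spectral a' b' c' = spectral (a * a') (b * b') (c * c')"
proof -
  have "diag3 a b c ** diag3 a' b' c' = diag3 (a * a') (b * b') (c * c')"
    by (simp add: diag3_def vec_eq_iff all_3' matrix_matrix_mult_def sum_UNIV_3')
  moreover have "spectral a b c ** spectral a' b' c'
      = matW ** (diag3 a b c ** (matV ** matW) ** diag3 a' b' c') ** matV"
    by (simp only: spectral_def matrix_mul_assoc)
  ultimately show ?thesis by (simp add: spectral_def V_W)
qed

lemma spectral_add: "spectral a b c + spectral a' b' c' = spectral (a + a') (b + b') (c + c')"
proof -
  have "diag3 a b c + diag3 a' b' c' = diag3 (a + a') (b + b') (c + c')"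
    by (simp add: diag3_def vec_eq_iff all_3')
  moreover have "(A + B) ** C = A ** C + B ** C" for A B C :: cmat
    by (simp add: vec_eq_iff matrix_matrix_mult_def sum.distrib distrib_right)
  ultimately show ?thesis
    by (metis spectral_def matrix_add_ldistrib)
qed

lemma cscale_matrix_mult:
  "cscale r (A ** B) = cscale r A ** B" "cscale r (A ** B) = A ** cscale r B"
  by (simp_all add: cscale_def map_matrix_def vec_eq_iff matrix_matrix_mult_def sum_distrib_left
      mult_ac)

lemma cscale_spectral: "cscale r (spectral a b c) = spectral (r * a) (r * b) (r * c)"
proof -
  have "cscale r (diag3 a b c) = diag3 (r * a) (r * b) (r * c)"
    by (simp add: diag3_def vec_eq_iff all_3' cscale_def map_matrix_def)
  then show ?thesis
    by (simp add: spectral_def cscale_matrix_mult(1)[of _ _ matV] cscale_matrix_mult(2)[of _ matW])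
qed

lemma spectral_diff: "spectral a b c - spectral a' b' c' = spectral (a - a') (b - b') (c - c')"
  by (simp add: diff_eq_eq spectral_add)

section \<open>Primitive cube roots of unity and their characters\<close>

text \<open>The last two columns of \<open>matW\<close> belong to \<omega> and its inverse, so each
  eigenvalue identity is proved once here and used at both roots.\<close>

locale primitive_cube_root =
  fixes \<zeta> :: complex
  assumes cubed: "\<zeta> ^ 3 = 1" and ne_1: "\<zeta> \<noteq> 1"
begin

lemma nonzero: "\<zeta> \<noteq> 0"
  using cubed by auto

lemma square: "\<zeta> * \<zeta> = - 1 - \<zeta>"
proof -
  have "(\<zeta> - 1) * (\<zeta> * \<zeta> - (- 1 - \<zeta>)) = 0"
    using cubed by (simp add: algebra_simps power3_eq_cube)
  then show ?thesis
    using ne_1 by (simp only: mult_eq_0_iff right_minus_eq simp_thms)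
qed

text \<open>The form of \<open>square\<close> for right-nested products; together they reduce
  polynomials in \<zeta> to degree at most one.\<close>

lemma square': "\<zeta> * (\<zeta> * u) = - u - \<zeta> * u"
  by (simp only: mult.assoc[symmetric] square) (simp add: left_diff_distrib)

lemma inverse_eq: "inverse \<zeta> = - 1 - \<zeta>"
  by (rule inverse_unique) (simp add: algebra_simps square)

lemma inverse_primitive: "primitive_cube_root (inverse \<zeta>)"
  by standard (use cubed ne_1 in \<open>auto simp: power_inverse\<close>)

end

text \<open>For \<zeta>^3 = 1 this is the character of Z/3Z sending 1 to \<zeta>. Unlike
  \<open>omega_pow\<close>, it is available at the inverse of \<omega> too.\<close>

definition cube_char :: "complex \<Rightarrow> 3 \<Rightarrow> complex" where
  "cube_char \<zeta> x = \<zeta> ^ rep3 x"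

lemma omega_pow_eq_cube_char: "omega_pow = cube_char \<omega>"
  by (simp add: fun_eq_iff omega_pow_def cube_char_def)

lemma cases_3: fixes x :: 3 obtains "x = 0" | "x = 1" | "x = 2"
  using UNIV_3' by blast

definition median_eigenvalue :: "complex \<Rightarrow> 3 \<Rightarrow> 3 \<Rightarrow> 3 \<Rightarrow> 3 \<Rightarrow> complex \<Rightarrow> complex" where
  "median_eigenvalue \<zeta> w x y z e
     = (cube_char \<zeta> x * e - cube_char \<zeta> w) / (cube_char \<zeta> z - cube_char \<zeta> y)"

context primitive_cube_root
begin

lemma cube_char_simps: "cube_char \<zeta> 0 = 1" "cube_char \<zeta> 1 = \<zeta>" "cube_char \<zeta> 2 = - 1 - \<zeta>"
  by (simp_all add: cube_char_def rep3_simps power2_eq_square square)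

lemma cube_char_add: "cube_char \<zeta> (x + y) = cube_char \<zeta> x * cube_char \<zeta> y"
  by (cases x rule: cases_3; cases y rule: cases_3)
    (simp_all add: mod3_reduce cube_char_simps algebra_simps square)

lemma cube_char_nonzero: "cube_char \<zeta> x \<noteq> 0"
  by (simp add: cube_char_def nonzero)

lemma cube_char_inverse: "cube_char (inverse \<zeta>) x = inverse (cube_char \<zeta> x)"
  by (simp add: cube_char_def power_inverse)

lemma cube_char_minus: "cube_char \<zeta> (- x) = inverse (cube_char \<zeta> x)"
proof -
  have "cube_char \<zeta> (- x) * cube_char \<zeta> x = 1"
    by (simp add: cube_char_simps flip: cube_char_add)
  then show ?thesis by (metis inverse_unique mult.commute)
qed

lemma cube_char_diff: "cube_char \<zeta> (x - y) = cube_char \<zeta> x / cube_char \<zeta> y"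
  using cube_char_add[of x "- y"] by (simp add: cube_char_minus divide_inverse)

text \<open>The kernel is trivial: \<zeta> is not 1, and \<zeta>^2 = 1 would give \<zeta> =
  \<zeta>^3 = 1. Hence the denominators of the median eigenvalues are nonzero for distinct
  \<open>y\<close> and \<open>z\<close>.\<close>

lemma cube_char_eq_iff: "cube_char \<zeta> x = cube_char \<zeta> y \<longleftrightarrow> x = y"
proof -
  have "cube_char \<zeta> d = 1 \<Longrightarrow> d = 0" for d
  proof (cases d rule: cases_3)
    case 3
    assume "cube_char \<zeta> d = 1"
    then have "\<zeta> ^ 2 = 1" using 3 by (simp add: cube_char_def rep3_simps)
    then have "\<zeta> ^ 3 = \<zeta>" by (simp add: power3_eq_cube power2_eq_square)
    then show ?thesis using cubed ne_1 by simp
  qed (use ne_1 in \<open>simp_all add: cube_char_simps\<close>)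
  from this[of "x - y"] show ?thesis by (auto simp: cube_char_diff cube_char_nonzero)
qed

section \<open>Identities between eigenvalues of median operators\<close>

lemma median_eigenvalue_shift_numerator:
  "median_eigenvalue \<zeta> (w + 1) (x + 1) y z e = median_eigenvalue \<zeta> w x y z e * \<zeta>"
  by (simp add: median_eigenvalue_def cube_char_add cube_char_simps algebra_simps)

lemma median_eigenvalue_shift_denominator:
  "median_eigenvalue \<zeta> w x (y + 1) (z + 1) e = median_eigenvalue \<zeta> w x y z e / \<zeta>"
  by (simp add: median_eigenvalue_def cube_char_add cube_char_simps flip: left_diff_distrib)

text \<open>The numerator depends on \<open>x\<close> and \<open>e\<close> only through \<zeta>^x e.
  At the inverse of \<omega>, dividing by \<zeta> means multiplying by \<omega>, whence the opposite
  twists of \<eta> and \<eta>'.\<close>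

lemma median_eigenvalue_add_1:
  "median_eigenvalue \<zeta> w (x + 1) y z (e / \<zeta>) = median_eigenvalue \<zeta> w x y z e"
  by (simp add: median_eigenvalue_def cube_char_add cube_char_simps nonzero)

lemma median_eigenvalue_diff_1:
  "median_eigenvalue \<zeta> w (x - 1) y z (e * \<zeta>) = median_eigenvalue \<zeta> w x y z e"
  by (simp add: median_eigenvalue_def cube_char_diff cube_char_simps nonzero)

text \<open>Since 1 + \<zeta> + \<zeta>^2 = 0, the terms in \<open>e\<close> cancel and only -3
  \<zeta>^w over the common denominator remains.\<close>

lemma median_eigenvalue_sum:
  assumes "y \<noteq> z"
  shows "median_eigenvalue \<zeta> w 0 y z e + median_eigenvalue \<zeta> w 1 y z e + median_eigenvalue \<zeta> w 2 y z e
    = cube_char \<zeta> (w + y + z) + 2 * cube_char \<zeta> (w - y)"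
proof -
  have nz: "cube_char \<zeta> z - cube_char \<zeta> y \<noteq> 0"
    using assms by (simp add: cube_char_eq_iff)
  \<comment> \<open>Modulo \<zeta>^3 = 1 the product expands to \<zeta>^(y-z) + \<zeta>^(z-y) - 2,
    and the two powers are the two primitive roots, with sum -1.\<close>
  have "(cube_char \<zeta> (y + z) + 2 * cube_char \<zeta> (- y)) * (cube_char \<zeta> z - cube_char \<zeta> y) = - 3"
    using assms
    by (cases y rule: cases_3; cases z rule: cases_3)
      (simp_all add: mod3_reduce cube_char_simps algebra_simps square square')
  then have "cube_char \<zeta> (y + z) + 2 * cube_char \<zeta> (- y) = - 3 / (cube_char \<zeta> z - cube_char \<zeta> y)"
    by (simp only: nonzero_eq_divide_eq[OF nz])
  then have "cube_char \<zeta> w * (cube_char \<zeta> (y + z) + 2 * cube_char \<zeta> (- y))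
      = - 3 * cube_char \<zeta> w / (cube_char \<zeta> z - cube_char \<zeta> y)"
    by simp
  moreover have "cube_char \<zeta> w * (cube_char \<zeta> (y + z) + 2 * cube_char \<zeta> (- y))
      = cube_char \<zeta> (w + y + z) + 2 * cube_char \<zeta> (w - y)"
    by (simp add: cube_char_add cube_char_diff cube_char_minus field_simps)
  ultimately show ?thesis
    by (simp add: median_eigenvalue_def cube_char_simps algebra_simps flip: add_divide_distrib)
qed

lemma median_eigenvalue_swap:
  "median_eigenvalue \<zeta> w x z y e = - median_eigenvalue \<zeta> w x y z e"
  by (metis median_eigenvalue_def minus_diff_eq divide_minus_right)

text \<open>The summand \<zeta>^(w-x) cancels \<zeta>^w in the numerator and leaves \<zeta>^x e; on
  the right the summand 1 does the same.\<close>

lemma median_eigenvalue_translate: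
  "median_eigenvalue \<zeta> w x y z (cube_char \<zeta> (w - x) + e)
    = cube_char \<zeta> x * median_eigenvalue \<zeta> 0 0 y z (1 + e)"
  by (simp add: median_eigenvalue_def cube_char_diff cube_char_simps cube_char_nonzero
      distrib_left)

end

section \<open>Spectral form of the shift and of the median operators\<close>

interpretation omega: primitive_cube_root \<omega>
  by standard (rule omega_cubed, rule omega_ne_1)

interpretation omega_inv: primitive_cube_root "inverse \<omega>"
  by (rule omega.inverse_primitive)

lemma matJ_eq_spectral: "matJ = spectral 1 \<omega> (inverse \<omega>)"
proof -
  \<comment> \<open>The columns of \<open>matW\<close> are eigenvectors of the cyclic shift;
    multiplying by \<open>matV\<close> on the right then gives the claim.\<close>
  have "matJ ** matW = matW ** diag3 1 \<omega> (inverse \<omega>)"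
    by (simp add: vec_eq_iff all_3' matrix_matrix_mult_def sum_UNIV_3' matJ_def matW_def diag3_def
        power2_eq_square omega.square omega.square' omega.inverse_eq algebra_simps)
  then show ?thesis
    by (simp add: spectral_def W_V flip: matrix_mul_assoc)
      (metis W_V matrix_mul_assoc matrix_mul_rid)
qed

lemma J_pow_eq_spectral:
  "J_pow x = spectral 1 (cube_char \<omega> x) (cube_char (inverse \<omega>) x)"
proof -
  have "(((**) matJ) ^^ n) (mat 1) = spectral 1 (\<omega> ^ n) (inverse \<omega> ^ n)" for n
    by (induction n) (simp_all add: mat_1_eq_spectral matJ_eq_spectral spectral_mult)
  then show ?thesis by (simp add: J_pow_def cube_char_def)
qed

text \<open>This turns the coordinatewise condition defining median triples into an equation between
  matrices.\<close>

lemma J_pow_mult_vec_nth: "(J_pow x *v \<Delta>) $ k = \<Delta> $ (x + k)"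
proof -
  have "\<forall>k. (J_pow x *v \<Delta>) $ k = \<Delta> $ (x + k)"
    by (cases x rule: cases_3)
      (simp_all add: J_pow_def rep3_simps all_3' numeral_2_eq_2 mod3_reduce
        matrix_vector_mult_def matrix_matrix_mult_def sum_UNIV_3' matJ_def mat_def)
  then show ?thesis by blast
qed

text \<open>On constant vectors the equation \<open>eq\<close> reads 0 = 0 and determines nothing;
  the centroid condition supplies the eigenvalue 1 there.\<close>

lemma median_eq_spectral:
  assumes "y \<noteq> z"
  shows "median w x y z \<eta> \<eta>'
    = spectral 1 (median_eigenvalue \<omega> w x y z \<eta>') (median_eigenvalue (inverse \<omega>) w x y z \<eta>)"
    (is "_ = ?M")
proof -
  have nz: "cube_char \<omega> z - cube_char \<omega> y \<noteq> 0"
      "cube_char (inverse \<omega>) z - cube_char (inverse \<omega>) y \<noteq> 0"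
    using assms by (simp_all add: omega.cube_char_eq_iff omega_inv.cube_char_eq_iff)
  have eq: "J_pow x ** cevian \<eta> \<eta>' - J_pow w = (J_pow z - J_pow y) ** ?M"
    using nz by (simp add: J_pow_eq_spectral cevian_eq_spectral spectral_mult spectral_diff
        median_eigenvalue_def)
  have "median w x y z \<eta> \<eta>' *v \<Delta> = ?M *v \<Delta>" for \<Delta>
  proof -
    have "(cevian \<eta> \<eta>' *v \<Delta>) $ (x + k) - \<Delta> $ (w + k)
        = (?M *v \<Delta>) $ (z + k) - (?M *v \<Delta>) $ (y + k)" for k
      using arg_cong[OF eq, of "\<lambda>A. (A *v \<Delta>) $ k"]
      by (simp add: matrix_vector_mult_diff_rdistrib J_pow_mult_vec_nth
          flip: matrix_vector_mul_assoc)
    \<comment> \<open>Having first eigenvalue 1, \<open>?M\<close> is itself a cevian operator with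
      other parameters.\<close>
    moreover have "centroid (?M *v \<Delta>) = centroid \<Delta>"
      using centroid_cevian by (simp add: cevian_eq_spectral)
    ultimately have "is_median_triple w x y z \<eta> \<eta>' \<Delta> (?M *v \<Delta>)"
      by (simp add: is_median_triple_def)
    then show ?thesis
      by (simp add: median_works[OF assms] median_op_iff[OF assms])
  qed
  then show ?thesis by (simp add: matrix_eq)
qed

theorem mainTheorem2:
  fixes \<eta> \<eta>' :: complex and w x y z :: 3
  assumes "y \<noteq> z"
  shows
    "(cevian \<eta> \<eta>' = cevian (\<eta> * \<omega>) (\<eta>' * inverse \<omega>) ** matJ \<and>
      cevian (\<eta> * \<omega>) (\<eta>' * inverse \<omega>) ** matJ = matJ ** cevian (\<eta> * \<omega>) (\<eta>' * inverse \<omega>)) \<and>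
     median w x y z \<eta> \<eta>' = median (w + 1) (x + 1) (y + 1) (z + 1) \<eta> \<eta>' \<and>
     median w x y z \<eta> \<eta>' ** matJ = median (w + 1) (x + 1) y z \<eta> \<eta>' \<and>
     median w x y z \<eta> \<eta>' ** (matJ ** matJ) = median w x (y + 1) (z + 1) \<eta> \<eta>' \<and>
     (median w x y z \<eta> \<eta>' = median w (x + 1) y z (\<eta> * \<omega>) (\<eta>' * inverse \<omega>) \<and>
      median w (x + 1) y z (\<eta> * \<omega>) (\<eta>' * inverse \<omega>)
        = median w (x - 1) y z (\<eta> * inverse \<omega>) (\<eta>' * \<omega>)) \<and>
     cscale (1 / 3) (median w 0 y z \<eta> \<eta>' + median w 1 y z \<eta> \<eta>' + median w 2 y z \<eta> \<eta>')
       = cscale (1 / 3) (J_pow (w + y + z)) + cscale (2 / 3) (J_pow (w - y)) \<and>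
     (cscale (1 / 2) (median w x y z \<eta> \<eta>' + median w x z y \<eta> \<eta>') = cevian_pq (1 / 2) (1 / 2) \<and>
      cevian_pq (1 / 2) (1 / 2) = cscale (1 / 3) (mat 1 + matJ + matJ ** matJ)) \<and>
     median w x y z (omega_pow (x - w) + \<eta>) (omega_pow (w - x) + \<eta>')
       = J_pow x ** median 0 0 y z (1 + \<eta>) (1 + \<eta>')"
proof -
  have inv_eq: "inverse (inverse \<omega>) = \<omega>" by simp
  have zy: "z \<noteq> y" and yz1: "y + 1 \<noteq> z + 1" using assms by simp_all
  note med = median_eq_spectral[OF assms] median_eq_spectral[OF zy] median_eq_spectral[OF yz1]
  have sq: "\<omega> * \<omega> = inverse \<omega>" "inverse \<omega> * inverse \<omega> = \<omega>"
    using omega_cubed omega.nonzero by (simp_all add: field_simps power3_eq_cube)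
  have e1: "cevian \<eta> \<eta>' = cevian (\<eta> * \<omega>) (\<eta>' * inverse \<omega>) ** matJ"
    and e1': "cevian (\<eta> * \<omega>) (\<eta>' * inverse \<omega>) ** matJ = matJ ** cevian (\<eta> * \<omega>) (\<eta>' * inverse \<omega>)"
    using omega.nonzero
    by (simp_all add: cevian_eq_spectral matJ_eq_spectral spectral_mult field_simps)
  have e2: "median w x y z \<eta> \<eta>' = median (w + 1) (x + 1) (y + 1) (z + 1) \<eta> \<eta>'"
    using omega.nonzero
    by (simp only: med omega.median_eigenvalue_shift_numerator
        omega.median_eigenvalue_shift_denominator omega_inv.median_eigenvalue_shift_numerator
        omega_inv.median_eigenvalue_shift_denominator) simp
  have e3: "median w x y z \<eta> \<eta>' ** matJ = median (w + 1) (x + 1) y z \<eta> \<eta>'"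
    by (simp only: med matJ_eq_spectral spectral_mult mult_1_right
        omega.median_eigenvalue_shift_numerator omega_inv.median_eigenvalue_shift_numerator)
  \<comment> \<open>Shifting the denominator multiplies by the inverse of J, which is J^2.\<close>
  have e4: "median w x y z \<eta> \<eta>' ** (matJ ** matJ) = median w x (y + 1) (z + 1) \<eta> \<eta>'"
    by (simp only: med matJ_eq_spectral spectral_mult mult_1_right sq divide_inverse inv_eq
        omega.median_eigenvalue_shift_denominator omega_inv.median_eigenvalue_shift_denominator)
  have e5: "median w x y z \<eta> \<eta>' = median w (x + 1) y z (\<eta> * \<omega>) (\<eta>' * inverse \<omega>)"
    using omega.median_eigenvalue_add_1[of w x y z \<eta>']
      omega_inv.median_eigenvalue_add_1[of w x y z \<eta>]
    by (simp add: med divide_inverse)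
  have e5': "median w x y z \<eta> \<eta>' = median w (x - 1) y z (\<eta> * inverse \<omega>) (\<eta>' * \<omega>)"
    by (simp only: med omega.median_eigenvalue_diff_1 omega_inv.median_eigenvalue_diff_1)
  have e6: "cscale (1 / 3) (median w 0 y z \<eta> \<eta>' + median w 1 y z \<eta> \<eta>' + median w 2 y z \<eta> \<eta>')
      = cscale (1 / 3) (J_pow (w + y + z)) + cscale (2 / 3) (J_pow (w - y))"
    by (simp add: med J_pow_eq_spectral spectral_add cscale_spectral
        omega.median_eigenvalue_sum[OF assms] omega_inv.median_eigenvalue_sum[OF assms]
        add_divide_distrib)
  \<comment> \<open>Both nonconstant eigenvalues of I + J + J^2 equal this sum, so the matrix is
    three times the projection onto the constant vectors.\<close>
  have "1 + \<omega> + inverse \<omega> = 0" by (simp add: omega.inverse_eq)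
  then have J_sum: "mat 1 + matJ + matJ ** matJ = spectral 3 0 0"
    by (simp add: mat_1_eq_spectral matJ_eq_spectral spectral_mult spectral_add sq ac_simps
        flip: inverse_mult_distrib)
  \<comment> \<open>All three coefficients are (1/4) / (3/4) = 1/3.\<close>
  have e7: "cevian_pq (1 / 2) (1 / 2) = cscale (1 / 3) (mat 1 + matJ + matJ ** matJ)"
    by (simp add: cevian_pq_def mat_1_eq_spectral matJ_eq_spectral spectral_mult spectral_add
        cscale_spectral add_divide_distrib)
  \<comment> \<open>Swapping \<open>y\<close> and \<open>z\<close> negates the nonconstant
    eigenvalues, so they cancel in the mean.\<close>
  have e7': "cscale (1 / 2) (median w x y z \<eta> \<eta>' + median w x z y \<eta> \<eta>')
      = cscale (1 / 3) (mat 1 + matJ + matJ ** matJ)"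
    by (simp add: med spectral_add cscale_spectral J_sum
        omega.median_eigenvalue_swap[of w x z y] omega_inv.median_eigenvalue_swap[of w x z y])
  \<comment> \<open>The parameter \<eta> sits at the inverse root, so its shift is rewritten as a
    character value there to fit \<open>median_eigenvalue_translate\<close>.\<close>
  have "omega_pow (x - w) = cube_char (inverse \<omega>) (w - x)"
    using omega.cube_char_minus[of "w - x"]
    by (simp add: omega_pow_eq_cube_char omega.cube_char_inverse)
  then have e8: "median w x y z (omega_pow (x - w) + \<eta>) (omega_pow (w - x) + \<eta>')
      = J_pow x ** median 0 0 y z (1 + \<eta>) (1 + \<eta>')"
    by (simp add: med J_pow_eq_spectral spectral_mult omega_pow_eq_cube_char
        omega.median_eigenvalue_translate omega_inv.median_eigenvalue_translate)
  show ?thesis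
    using e1 e1' e2 e3 e4 e5 e5' e6 e7 e7' e8 by metis
qed

end
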